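(* Let $q\ge 2$ be an integer. The Ramanujan operator $\hat R_q$ has all three properties of a first derivative in the discrete sense, that is: (1) (zero in areas of constant intensity) if a signal $x:\mathbb Z\to\mathbb R$ and $n\in\mathbb Z$ are such that $x(n)=x(n-1)=\cdots=x(n-q+1)$, then $(\hat R_q x)(n)=0$; (2) (nonzero at the onset of a unit step or a ramp) for every $n_0\in\mathbb Z$, if $x$ is the unit step with onset $n_0$, or a ramp of slope $a\neq 0$ with onset $n_0$, then $(\hat R_q x)(n_0)\neq 0$; (3) (nonzero constant along ramps) for every real $a\ne 0$ there is a nonzero constant $C$ (depending only on $q$ and $a$) such that, whenever $x:\mathbb Z\to\mathbb R$, $b\in\mathbb R$ and $n\in\mathbb Z$ satisfy $x(m)=am+b$ for all integers $m$ with $n-q+1\le m\le n$, one has $(\hat R_q x)(n)=C$.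
   Context: For a positive integer $q$ and $n\in\mathbb Z$, the Ramanujan sum is $c_q(n)=\sum_{1\le k\le q,\ \gcd(k,q)=1} e^{2\pi i kn/q}$; it is $q$-periodic in $n$. For $q\neq 1$, let $\hat c_q(n)=c_q(n)$ for $0\le n\le q-1$ and $\hat c_q(n)=0$ for all other integers $n$. The Ramanujan operator $\hat R_q$ is the linear shift-invariant operator with kernel $\hat c_q$: for a signal $x:\mathbb Z\to\mathbb R$, $(\hat R_q x)(n)=\sum_{k}\hat c_q(k)\,x(n-k)=\sum_{k=0}^{q-1}c_q(k)\,x(n-k)$. The unit step with onset $n_0$ is the signal equal to $1$ for $n\ge n_0$ and $0$ for $n<n_0$. The ramp of slope $a$ with onset $n_0$ is the signal equal to $a(n-n_0+1)$ for $n\ge n_0$ and $0$ for $n<n_0$ (so $n_0$ is its first nonzero sample). *)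

theory Defs
  imports "HOL-Analysis.Analysis"
begin

definition ramanujan_sum :: "nat \<Rightarrow> int \<Rightarrow> complex" where
  "ramanujan_sum q n =
     (\<Sum>k | 1 \<le> k \<and> k \<le> q \<and> coprime k q. exp (2 * of_real pi * \<i> * of_nat k * of_int n / of_nat q))"

(* The kernel is only meant for q > 1; other values of q are not given a separate convention. *)
definition ramanujan_kernel :: "nat \<Rightarrow> int \<Rightarrow> complex" where
  "ramanujan_kernel q n = (if 0 \<le> n \<and> n \<le> int q - 1 then ramanujan_sum q n else 0)"

(* The Ramanujan sums are real, but they are introduced here as sums of complex exponentials,
   so the operator formally maps real signals to complex-valued ones.  The kernel has finite
   support, hence the series is a finite sum (lemma ramanujan_op_finite_sum below). *)
definition ramanujan_op :: "nat \<Rightarrow> (int \<Rightarrow> real) \<Rightarrow> int \<Rightarrow> complex" where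
  "ramanujan_op q x n = (\<Sum>\<^sub>\<infinity>k. ramanujan_kernel q k * of_real (x (n - k)))"

definition unit_step :: "int \<Rightarrow> int \<Rightarrow> real" where
  "unit_step n0 n = (if n \<ge> n0 then 1 else 0)"

(* The onset n0 is the first nonzero sample: for a \<noteq> 0 the value there is a, not 0. *)
definition ramp :: "real \<Rightarrow> int \<Rightarrow> int \<Rightarrow> real" where
  "ramp a n0 n = (if n \<ge> n0 then a * of_int (n - n0 + 1) else 0)"

lemma ramanujan_op_finite_sum:
  "ramanujan_op q x n = (\<Sum>k<q. ramanujan_sum q (int k) * of_real (x (n - int k)))"
proof -
  have "ramanujan_op q x n =
      (\<Sum>\<^sub>\<infinity>k\<in>int ` {..<q}. ramanujan_kernel q k * of_real (x (n - k)))"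
    unfolding ramanujan_op_def
  proof (rule infsum_cong_neutral)
    fix k assume "k \<in> UNIV - int ` {..<q}"
    then have "\<not> (0 \<le> k \<and> k \<le> int q - 1)"
      by (auto simp: image_iff elim!: nonneg_int_cases)
    then show "ramanujan_kernel q k * of_real (x (n - k)) = 0"
      by (auto simp: ramanujan_kernel_def)
  qed auto
  also have "\<dots> = (\<Sum>k\<in>int ` {..<q}. ramanujan_kernel q k * of_real (x (n - k)))"
    by (rule infsum_finite) simp
  also have "\<dots> = (\<Sum>k<q. ramanujan_sum q (int k) * of_real (x (n - int k)))"
    by (subst sum.reindex) (auto simp: ramanujan_kernel_def intro!: sum.cong)
  finally show ?thesis .
qed

end

theory Submission
  imports Defs "HOL-Number_Theory.Totient"
begin

text \<open>
  Everything rests on three facts about the Ramanujan sums over one period: \<open>c\<^sub>q(0) = \<phi>(q)\<close>,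
  the zeroth moment \<open>\<Sum>k<q. c\<^sub>q(k)\<close> vanishes, and the first moment \<open>\<Sum>k<q. k c\<^sub>q(k)\<close> equals
  \<open>-q \<phi>(q) / 2\<close>.  The zeroth moment vanishes because \<open>c\<^sub>q\<close> is a sum of the geometric
  progressions \<open>w\<^sup>k\<close> over primitive \<open>q\<close>-th roots of unity \<open>w\<close>, none of which is \<open>1\<close> when
  \<open>q \<ge> 2\<close>.  The first moment could be computed from the values \<open>q / (w - 1)\<close> of the sums
  \<open>\<Sum>k<q. k w\<^sup>k\<close>, but the reflection \<open>c\<^sub>q(q - k) = c\<^sub>q(k)\<close> gives it directly: averaging
  the sum with its reversal replaces the weight \<open>k\<close> by \<open>q / 2\<close> for \<open>0 < k < q\<close>, so that twice the
  moment is \<open>q\<close> times the zeroth moment without its term \<open>c\<^sub>q(0)\<close>.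

  The operator annihilates constants by the zeroth moment.  At an onset, only the present sample
  is nonzero, so the output is that sample times \<open>\<phi>(q)\<close>.  On an affine stretch \<open>a m + b\<close> the
  part that depends on position is constant over the window and is killed, which leaves
  \<open>-a\<close> times the first moment, that is \<open>a q \<phi>(q) / 2\<close>.
\<close>

lemma ramanujan_sum_0: "ramanujan_sum q 0 = of_nat (totient q)"
proof -
  have "{k. 1 \<le> k \<and> k \<le> q \<and> coprime k q} = totatives q"
    by (auto simp: totatives_def)
  then show ?thesis
    by (simp add: ramanujan_sum_def totient_def)
qed

text \<open>
  Summing over a full period first, each index \<open>j\<close> contributes the geometric sum of
  \<open>w = exp (2\<pi>\<i>j/q)\<close>, a \<open>q\<close>-th root of unity; coprimality of \<open>j\<close> and \<open>q \<ge> 2\<close> forces \<open>w \<noteq> 1\<close>.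
\<close>
lemma sum_ramanujan_sum_period:
  assumes "q \<ge> 2"
  shows "(\<Sum>k<q. ramanujan_sum q (int k)) = 0"
proof -
  have "(\<Sum>k<q. exp (2 * of_real pi * \<i> * of_nat j * of_int (int k) / of_nat q)) = (0::complex)"
    if "coprime j q" for j
  proof -
    define w :: complex where "w = exp (2 * of_real pi * \<i> * of_nat j / of_nat q)"
    have "\<not> q dvd j"
      using that assms coprime_common_divisor_nat[of j q q] by auto
    then have "w \<noteq> 1"
      using assms unfolding w_def by (subst complex_root_unity_eq_1) auto
    moreover have "w ^ q = 1"
      using assms unfolding w_def by (intro complex_root_unity) auto
    ultimately have "(\<Sum>k<q. w ^ k) = 0"
      by (simp add: geometric_sum)
    moreover have "exp (2 * of_real pi * \<i> * of_nat j * of_int (int k) / of_nat q) = w ^ k" for k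
      unfolding w_def by (subst exp_of_nat_mult[symmetric]) (simp add: field_simps)
    ultimately show ?thesis by simp
  qed
  then show ?thesis
    unfolding ramanujan_sum_def by (subst sum.swap) (auto intro!: sum.neutral)
qed

text \<open>
  The involution \<open>j \<mapsto> q - j\<close> of the residues coprime to \<open>q\<close> changes the exponent
  \<open>j (q - n) / q\<close> into \<open>j n / q\<close> up to an integer.  For \<open>q = 1\<close> it would leave the index range
  \<open>{1..q}\<close>, hence the bound.
\<close>
lemma ramanujan_sum_reflect:
  assumes "q \<ge> 2"
  shows "ramanujan_sum q (int q - n) = ramanujan_sum q n"
proof -
  let ?A = "{j. 1 \<le> j \<and> j \<le> q \<and> coprime j q}"
  have inv: "q - j \<in> ?A \<and> q - (q - j) = j" if "j \<in> ?A" for j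
  proof -
    from that have j: "1 \<le> j" "j \<le> q" "coprime j q" by auto
    have "j \<noteq> q" using j assms by auto
    moreover have "coprime (q - j) q"
      using j by (simp add: coprime_iff_gcd_eq_1 gcd_diff2_nat)
    ultimately show ?thesis using j by auto
  qed
  show ?thesis
    unfolding ramanujan_sum_def
  proof (rule sum.reindex_bij_witness[of _ "\<lambda>j. q - j" "\<lambda>j. q - j"])
    fix j assume "j \<in> ?A"
    then have j: "j \<le> q" by simp
    have "2 * of_real pi * \<i> * of_nat (q - j) * of_int n / of_nat q
        = 2 * of_real pi * \<i> * of_nat j * of_int (int q - n) / of_nat q
          + of_real (of_int (2 * (n - int j)) * pi) * \<i>"
      using assms j by (simp add: of_nat_diff field_simps)
    then show "exp (2 * of_real pi * \<i> * of_nat (q - j) * of_int n / of_nat q)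
        = exp (2 * of_real pi * \<i> * of_nat j * of_int (int q - n) / of_nat q)"
      unfolding exp_eq by blast
  qed (use inv in blast)+
qed

lemma sum_index_times_ramanujan_sum:
  assumes "q \<ge> 2"
  shows "(\<Sum>k<q. of_nat k * ramanujan_sum q (int k)) = - of_nat (q * totient q) / 2"
proof -
  let ?c = "\<lambda>k. ramanujan_sum q (int k)"
  let ?S = "\<Sum>k\<in>{1..<q}. of_nat k * ?c k"
  have split0: "(\<Sum>k<q. f k) = f 0 + (\<Sum>k\<in>{1..<q}. f k)" for f :: "nat \<Rightarrow> complex"
    using assms by (simp add: lessThan_atLeast0 sum.atLeast_Suc_lessThan)
  have "?S = (\<Sum>k\<in>{1..<q}. of_nat (q - k) * ?c k)"
  proof (rule sum.reindex_bij_witness[of _ "\<lambda>k. q - k" "\<lambda>k. q - k"])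
    fix k assume "k \<in> {1..<q}"
    then show "of_nat (q - (q - k)) * ?c (q - k) = of_nat k * ?c k"
      using ramanujan_sum_reflect[OF assms, of "int k"] by (simp add: of_nat_diff)
  qed auto
  then have "2 * ?S = (\<Sum>k\<in>{1..<q}. of_nat k * ?c k) + (\<Sum>k\<in>{1..<q}. of_nat (q - k) * ?c k)"
    by simp
  also have "\<dots> = (\<Sum>k\<in>{1..<q}. of_nat q * ?c k)"
    unfolding sum.distrib[symmetric] by (intro sum.cong) (auto simp: of_nat_diff algebra_simps)
  also have "\<dots> = of_nat q * (\<Sum>k\<in>{1..<q}. ?c k)"
    by (simp add: sum_distrib_left)
  also have "(\<Sum>k\<in>{1..<q}. ?c k) = - of_nat (totient q)"
    using sum_ramanujan_sum_period[OF assms] split0[of ?c]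
    by (simp add: ramanujan_sum_0 add_eq_0_iff)
  finally have "?S = - of_nat (q * totient q) / 2"
    by (simp add: field_simps)
  then show ?thesis
    by (simp add: split0)
qed

text \<open>
  Constant stretches are the case \<open>a = 0\<close>, so this covers both the zero response to constant
  signals and the constant response to ramps.
\<close>
lemma ramanujan_op_affine:
  assumes "q \<ge> 2"
    and x: "\<And>m. n - int q + 1 \<le> m \<Longrightarrow> m \<le> n \<Longrightarrow> x m = a * of_int m + b"
  shows "ramanujan_op q x n = complex_of_real (a * of_nat (q * totient q) / 2)"
proof -
  have "ramanujan_op q x n
      = (\<Sum>k<q. ramanujan_sum q (int k) * of_real (a * of_int (n - int k) + b))"
    unfolding ramanujan_op_finite_sum by (intro sum.cong) (auto simp: x)
  also have "\<dots> = of_real (a * of_int n + b) * (\<Sum>k<q. ramanujan_sum q (int k))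
      - of_real a * (\<Sum>k<q. of_nat k * ramanujan_sum q (int k))"
    unfolding sum_distrib_left sum_subtractf[symmetric]
    by (intro sum.cong) (auto simp: algebra_simps)
  also have "\<dots> = complex_of_real (a * of_nat (q * totient q) / 2)"
    by (simp add: sum_ramanujan_sum_period[OF assms(1)] sum_index_times_ramanujan_sum[OF assms(1)])
  finally show ?thesis .
qed

lemma ramanujan_op_onset:
  assumes "q > 0" and "\<And>m. m < n0 \<Longrightarrow> x m = 0"
  shows "ramanujan_op q x n0 = of_nat (totient q) * of_real (x n0)"
proof -
  have "ramanujan_op q x n0
      = (\<Sum>k\<in>{0}. ramanujan_sum q (int k) * of_real (x (n0 - int k)))"
    unfolding ramanujan_op_finite_sum
    by (intro sum.mono_neutral_right) (use assms in auto)
  then show ?thesis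
    by (simp add: ramanujan_sum_0)
qed

theorem theorem2p1:
  fixes q :: nat
  assumes "q \<ge> 2"
  shows
    "(\<forall>(x :: int \<Rightarrow> real) n.
        (\<forall>m. n - int q + 1 \<le> m \<and> m \<le> n \<longrightarrow> x m = x n) \<longrightarrow> ramanujan_op q x n = 0)
   \<and> (\<forall>n0. ramanujan_op q (unit_step n0) n0 \<noteq> 0
          \<and> (\<forall>a. a \<noteq> 0 \<longrightarrow> ramanujan_op q (ramp a n0) n0 \<noteq> 0))
   \<and> (\<forall>a::real. a \<noteq> 0 \<longrightarrow>
        (\<exists>C::real. C \<noteq> 0 \<and>
          (\<forall>(x :: int \<Rightarrow> real) (b::real) n.
             (\<forall>m. n - int q + 1 \<le> m \<and> m \<le> n \<longrightarrow> x m = a * of_int m + b)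
             \<longrightarrow> ramanujan_op q x n = complex_of_real C)))"
proof (intro conjI allI impI)
  fix x :: "int \<Rightarrow> real" and n
  assume "\<forall>m. n - int q + 1 \<le> m \<and> m \<le> n \<longrightarrow> x m = x n"
  then have "x m = 0 * of_int m + x n" if "n - int q + 1 \<le> m" "m \<le> n" for m
    using that by (metis add_0 mult_zero_left)
  from ramanujan_op_affine[OF assms this] show "ramanujan_op q x n = 0"
    by simp
next
  fix n0
  show "ramanujan_op q (unit_step n0) n0 \<noteq> 0"
    using assms by (subst ramanujan_op_onset) (auto simp: unit_step_def)
next
  fix n0 :: int and a :: real
  assume "a \<noteq> 0"
  then show "ramanujan_op q (ramp a n0) n0 \<noteq> 0"
    using assms by (subst ramanujan_op_onset) (auto simp: ramp_def)
next
  fix a :: real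
  assume "a \<noteq> 0"
  show "\<exists>C. C \<noteq> 0 \<and> (\<forall>(x :: int \<Rightarrow> real) b n.
      (\<forall>m. n - int q + 1 \<le> m \<and> m \<le> n \<longrightarrow> x m = a * of_int m + b)
      \<longrightarrow> ramanujan_op q x n = complex_of_real C)"
  proof (intro exI conjI allI impI)
    show "a * of_nat (q * totient q) / 2 \<noteq> 0"
      using \<open>a \<noteq> 0\<close> assms by auto
  next
    fix x :: "int \<Rightarrow> real" and b n
    assume "\<forall>m. n - int q + 1 \<le> m \<and> m \<le> n \<longrightarrow> x m = a * of_int m + b"
    then show "ramanujan_op q x n = complex_of_real (a * of_nat (q * totient q) / 2)"
      by (intro ramanujan_op_affine[OF assms]) auto
  qed
qed

end
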